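(* Consider an instance of configuration balancing with stochastic requests and let $\mathbb{E}[\mathrm{OPT}]$ be the expected makespan of an optimal adaptive policy. For any truncation threshold $\tau\ge 2\,\mathbb{E}[\mathrm{OPT}]$, there exists an adaptive policy whose expected makespan is at most $2\,\mathbb{E}[\mathrm{OPT}]$ and whose total expected exceptional load with respect to $\tau$ is at most $2\,\mathbb{E}[\mathrm{OPT}]$. Further, every configuration $c$ of a request $j$ selected by this policy satisfies $\mathbb{E}\big[\max_i X_{ij}(c)\big]\le\tau$.
   Context: Configuration balancing with stochastic requests: there are $m$ resources and $n$ requests. Request $j$ has configurations $c\in[q_j]$, each a random vector $X_j(c)=(X_{1j}(c),\dots,X_{mj}(c))\in\mathbb{R}_{\ge0}^m$ with known distribution, independent across different requests. A policy selects one configuration $c_j$ for each request irrevocably, observing the realized vector $X_j(c_j)$ only after selection; an adaptive policy may base its choices on previously observed realizations (so $c_j$ may itself be random). Its makespan is $\max_i\sum_j X_{ij}(c_j)$. For a threshold $\tau\ge0$ and random variable $X$, its exceptional part is $X^E:=X\cdot\mathbb{1}_{X\ge\tau}$ (and its truncated part is $X^T := X\cdot \mathbb{1}_{X<\tau}$). The total expected exceptional load of a policy with respect to $\tau$ is $\sum_{j=1}^n\mathbb{E}\big[\max_{1\le i\le m}X_{ij}^E(c_j)\big]$, where $c_j$ is the configuration the policy chooses for request $j$. *)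

theory Defs
  imports "HOL-Probability.Probability"
begin

text \<open>
  The resources are the elements of the finite type \<open>'m\<close>, the requests are \<open>{..<n}\<close> and the
  configurations of request \<open>j\<close> are \<open>{..<q j}\<close>. Independence is required only across requests:
  the vectors \<open>X j c\<close> of one request may be correlated arbitrarily, both between configurations
  and between resources.
\<close>

locale config_balancing = prob_space M
  for M :: "'w measure" +
  fixes n :: nat
    and q :: "nat \<Rightarrow> nat"
    and X :: "nat \<Rightarrow> nat \<Rightarrow> 'w \<Rightarrow> real ^ 'm::finite"
  assumes config_exists: "\<And>j. j < n \<Longrightarrow> 0 < q j"
    and nonneg: "\<And>j c \<omega> i. j < n \<Longrightarrow> c < q j \<Longrightarrow> \<omega> \<in> space M \<Longrightarrow> 0 \<le> X j c \<omega> $ i"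
    and indep: "indep_vars (\<lambda>j. PiM {..<q j} (\<lambda>_. borel))
                  (\<lambda>j \<omega>. \<lambda>c\<in>{..<q j}. X j c \<omega>) {..<n}"

text \<open>
  A policy is a decision tree: \<open>\<pi> k v\<close> is the pair of the request handled in step \<open>k\<close> and the
  configuration selected for it, given that the vectors observed in the earlier steps are
  \<open>v 0, \<dots>, v (k - 1)\<close>. The earlier choices are themselves determined by these vectors, so they
  are not recorded separately. The order of the requests may depend on the observations too.
\<close>

type_synonym 'm policy = "nat \<Rightarrow> (nat \<Rightarrow> real ^ 'm) \<Rightarrow> nat \<times> nat"

definition adaptive_policy :: "nat \<Rightarrow> (nat \<Rightarrow> nat) \<Rightarrow> 'm::finite policy \<Rightarrow> bool" where
  "adaptive_policy n q \<pi> \<longleftrightarrow>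
     (\<forall>k<n. \<pi> k \<in> PiM {..<k} (\<lambda>_. borel) \<rightarrow>\<^sub>M count_space UNIV) \<and>
     (\<forall>v. bij_betw (\<lambda>k. fst (\<pi> k (restrict v {..<k}))) {..<n} {..<n}) \<and>
     (\<forall>v. \<forall>k<n. case \<pi> k (restrict v {..<k}) of (j, c) \<Rightarrow> c < q j)"

primrec observed ::
  "(nat \<Rightarrow> nat \<Rightarrow> 'w \<Rightarrow> real ^ 'm) \<Rightarrow> 'm::finite policy \<Rightarrow> nat \<Rightarrow> 'w \<Rightarrow> nat \<Rightarrow> real ^ 'm" where
  "observed X \<pi> 0 \<omega> = (\<lambda>_. undefined)"
| "observed X \<pi> (Suc k) \<omega> =
     (observed X \<pi> k \<omega>)(k := (case \<pi> k (observed X \<pi> k \<omega>) of (j, c) \<Rightarrow> X j c \<omega>))"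

text \<open>The random configuration \<open>c\<^sub>j\<close> selected for request \<open>j\<close>.\<close>

definition selected ::
  "nat \<Rightarrow> (nat \<Rightarrow> nat \<Rightarrow> 'w \<Rightarrow> real ^ 'm) \<Rightarrow> 'm::finite policy \<Rightarrow> nat \<Rightarrow> 'w \<Rightarrow> nat" where
  "selected n X \<pi> j \<omega> = (THE c. \<exists>k<n. \<pi> k (observed X \<pi> k \<omega>) = (j, c))"

definition makespan ::
  "nat \<Rightarrow> (nat \<Rightarrow> nat \<Rightarrow> 'w \<Rightarrow> real ^ 'm) \<Rightarrow> 'm::finite policy \<Rightarrow> 'w \<Rightarrow> real" where
  "makespan n X \<pi> \<omega> = (MAX i. \<Sum>j<n. X j (selected n X \<pi> j \<omega>) \<omega> $ i)"

text \<open>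
  All loads are nonnegative but need not be integrable, so expectations are taken in
  \<open>[0, \<infinity>]\<close>.
\<close>

definition expected_makespan ::
  "'w measure \<Rightarrow> nat \<Rightarrow> (nat \<Rightarrow> nat \<Rightarrow> 'w \<Rightarrow> real ^ 'm) \<Rightarrow> 'm::finite policy \<Rightarrow> ennreal" where
  "expected_makespan M n X \<pi> = (\<integral>\<^sup>+\<omega>. ennreal (makespan n X \<pi> \<omega>) \<partial>M)"

definition expected_opt ::
  "'w measure \<Rightarrow> nat \<Rightarrow> (nat \<Rightarrow> nat) \<Rightarrow> (nat \<Rightarrow> nat \<Rightarrow> 'w \<Rightarrow> real ^ 'm::finite) \<Rightarrow> ennreal" where
  "expected_opt M n q X = (INF \<pi>\<in>{\<pi>. adaptive_policy n q \<pi>}. expected_makespan M n X \<pi>)"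

lemma expected_opt_eq_optimal_policy:
  assumes "adaptive_policy n q \<pi>"
    and "\<And>\<pi>'. adaptive_policy n q \<pi>' \<Longrightarrow> expected_makespan M n X \<pi> \<le> expected_makespan M n X \<pi>'"
  shows "expected_opt M n q X = expected_makespan M n X \<pi>"
  unfolding expected_opt_def using assms by (intro antisym INF_lower INF_greatest) auto

definition exceptional_part :: "real \<Rightarrow> real \<Rightarrow> real" where
  "exceptional_part \<tau> x = x * indicator {\<tau>..} x"

definition expected_exceptional_load ::
  "'w measure \<Rightarrow> nat \<Rightarrow> (nat \<Rightarrow> nat \<Rightarrow> 'w \<Rightarrow> real ^ 'm) \<Rightarrow> real \<Rightarrow> 'm::finite policy \<Rightarrow> ennreal" where
  "expected_exceptional_load M n X \<tau> \<pi> =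
     (\<Sum>j<n. \<integral>\<^sup>+\<omega>. ennreal (MAX i. exceptional_part \<tau> (X j (selected n X \<pi> j \<omega>) \<omega> $ i)) \<partial>M)"

end

theory Submission
  imports Defs
begin

text \<open>
  Let \<open>V J l\<close> be the least expected makespan when the requests \<open>J\<close> remain and the load so far is
  \<open>l\<close>, given by Bellman's recursion. By independence \<open>V {..<n} 0\<close> is a lower bound for
  every adaptive policy. The policy of the theorem plays the minimiser of the recursion in phases:
  it forgets the load \<open>l\<close> accumulated so far, and starts afresh on the remaining requests, as soon
  as some observed vector has an entry of at least \<open>\<tau>\<close>, or the minimiser asks for a configuration
  whose expected maximum exceeds \<open>\<tau>\<close>. In both cases \<open>V J l\<close> is at least \<open>\<tau>\<close>, which
  dominates \<open>2 * V J 0\<close>, the bound on the cost of everything after the restart. Hence backward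
  induction bounds the expected cost from the state \<open>(J, l)\<close> by \<open>2 * V J l\<close>. A minimiser asking
  for a forbidden configuration at load \<open>0\<close> would give \<open>V J 0 > \<tau>\<close>, so such configurations are
  never selected.
\<close>

subsection \<open>Integration along the decision tree\<close>

text \<open>Independence turns the joint law into a product measure, where Fubini separates
  coordinate \<open>i\<close> from the rest; the rest is then drawn in a fresh scenario
  \<omega>'.\<close>

lemma (in prob_space) nn_integral_indep_resample:
  assumes indep: "indep_vars N Y I" and I: "finite I" "i \<in> I"
    and f: "f \<in> borel_measurable (PiM I N)"
  shows "(\<integral>\<^sup>+\<omega>. f (\<lambda>j\<in>I. Y j \<omega>) \<partial>M) =
    (\<integral>\<^sup>+\<omega>. \<integral>\<^sup>+\<omega>'. f ((\<lambda>j\<in>I. Y j \<omega>')(i := Y i \<omega>)) \<partial>M \<partial>M)"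
proof -
  have rv[measurable]: "\<And>j. j \<in> I \<Longrightarrow> Y j \<in> M \<rightarrow>\<^sub>M N j"
    using indep by (simp add: indep_vars_def)
  \<comment> \<open>\<open>product_prob_space\<close> demands a probability measure at every index,
    so a Dirac measure fills the indices outside \<open>I\<close>.\<close>
  define D where "D j = (if j \<in> I then distr M (N j) (Y j) else return (count_space UNIV) undefined)" for j
  have prob_D: "prob_space (D j)" for j
    by (auto simp: D_def intro!: prob_space_distr prob_space_return)
  interpret D: product_prob_space D
    by (intro product_prob_spaceI prob_D)
  define K where "K = I - {i}"
  have K: "finite K" "i \<notin> K" "insert i K = I"
    using I by (auto simp: K_def)
  have sets_P: "sets (PiM I D) = sets (PiM I N)"
    by (intro sets_PiM_cong) (auto simp: D_def)
  have DI: "D i = distr M (N i) (Y i)"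
    using I by (simp add: D_def)
  have P: "distr M (PiM I N) (\<lambda>\<omega>. \<lambda>j\<in>I. Y j \<omega>) = PiM I D"
  proof -
    have "distr M (PiM I N) (\<lambda>\<omega>. \<lambda>j\<in>I. Y j \<omega>) = PiM I (\<lambda>j. distr M (N j) (Y j))"
      using indep I by (subst indep_vars_iff_distr_eq_PiM'[symmetric]) auto
    also have "\<dots> = PiM I D"
      by (intro PiM_cong) (auto simp: D_def)
    finally show ?thesis .
  qed
  have joint: "(\<integral>\<^sup>+\<omega>. g (\<lambda>j\<in>I. Y j \<omega>) \<partial>M) = (\<integral>\<^sup>+x. g x \<partial>PiM I D)"
    if "g \<in> borel_measurable (PiM I N)" for g
    using that by (subst P[symmetric], subst nn_integral_distr) (auto intro!: measurable_restrict)
  have f': "f \<in> borel_measurable (PiM (insert i K) D)"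
    using f K sets_P by (simp cong: measurable_cong_sets)
  \<comment> \<open>Coordinate \<open>i\<close> is overwritten by \<open>a\<close>, so integrating
    out its old value contributes the factor 1.\<close>
  have inner: "(\<integral>\<^sup>+\<omega>'. f ((\<lambda>j\<in>I. Y j \<omega>')(i := a)) \<partial>M) = (\<integral>\<^sup>+x. f (x(i := a)) \<partial>PiM K D)"
    if a: "a \<in> space (N i)" for a
  proof -
    have upd: "(\<lambda>x. x(i := a)) \<in> PiM I N \<rightarrow>\<^sub>M PiM I N"
      using I a by (intro measurable_fun_upd[where J = I]) auto
    have m: "(\<lambda>x. f (x(i := a))) \<in> borel_measurable (PiM I N)"
      using measurable_compose[OF upd f] .
    then have m': "(\<lambda>x. f (x(i := a))) \<in> borel_measurable (PiM (insert i K) D)"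
      using K sets_P by (simp cong: measurable_cong_sets)
    have "(\<integral>\<^sup>+\<omega>'. f ((\<lambda>j\<in>I. Y j \<omega>')(i := a)) \<partial>M) = (\<integral>\<^sup>+x. f (x(i := a)) \<partial>PiM (insert i K) D)"
      using joint[OF m] K by simp
    also have "\<dots> = (\<integral>\<^sup>+x. \<integral>\<^sup>+y. f (x(i := a)) \<partial>D i \<partial>PiM K D)"
      by (subst D.product_nn_integral_insert[OF K(1,2) m']) simp
    also have "\<dots> = (\<integral>\<^sup>+x. f (x(i := a)) \<partial>PiM K D)"
      by (simp add: prob_space.emeasure_space_1[OF prob_D])
    finally show ?thesis .
  qed
  have "(\<integral>\<^sup>+\<omega>. f (\<lambda>j\<in>I. Y j \<omega>) \<partial>M) = (\<integral>\<^sup>+x. f x \<partial>PiM (insert i K) D)"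
    using joint[OF f] K by simp
  also have "\<dots> = (\<integral>\<^sup>+y. \<integral>\<^sup>+x. f (x(i := y)) \<partial>PiM K D \<partial>D i)"
    by (rule D.product_nn_integral_insert_rev[OF K(1,2) f'])
  also have "\<dots> = (\<integral>\<^sup>+\<omega>. \<integral>\<^sup>+x. f (x(i := Y i \<omega>)) \<partial>PiM K D \<partial>M)"
  proof -
    interpret KD: prob_space "PiM K D"
      by (intro prob_space_PiM prob_D)
    have [measurable]: "f \<in> borel_measurable (PiM (insert i K) D)" by fact
    have "(\<lambda>y. \<integral>\<^sup>+x. f (x(i := y)) \<partial>PiM K D) \<in> borel_measurable (D i)"
      by measurable
    then show ?thesis
      unfolding DI using I by (subst nn_integral_distr) auto
  qed
  also have "\<dots> = (\<integral>\<^sup>+\<omega>. \<integral>\<^sup>+\<omega>'. f ((\<lambda>j\<in>I. Y j \<omega>')(i := Y i \<omega>)) \<partial>M \<partial>M)"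
    using I by (intro nn_integral_cong inner[symmetric] measurable_space[OF rv])
  finally show ?thesis .
qed

text \<open>
  \<open>continue X \<pi> k v r \<omega>\<close> plays \<open>r\<close> further steps of \<open>\<pi>\<close> from a fixed history \<open>v\<close> of length
  \<open>k\<close>. The scenario type is left open so that \<open>X\<close> can also be the coordinate projections of the
  product space, on which independence is available.
\<close>

primrec continue ::
  "(nat \<Rightarrow> nat \<Rightarrow> 'w \<Rightarrow> real ^ 'm) \<Rightarrow> 'm::finite policy \<Rightarrow> nat \<Rightarrow> (nat \<Rightarrow> real ^ 'm) \<Rightarrow> nat \<Rightarrow> 'w \<Rightarrow>
    nat \<Rightarrow> real ^ 'm" where
  "continue X \<pi> k v 0 \<omega> = v"
| "continue X \<pi> k v (Suc r) \<omega> = (continue X \<pi> k v r \<omega>)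
     (k + r := (case \<pi> (k + r) (continue X \<pi> k v r \<omega>) of (j, c) \<Rightarrow> X j c \<omega>))"

lemma observed_eq_continue: "observed X \<pi> r \<omega> = continue X \<pi> 0 (\<lambda>_. undefined) r \<omega>"
  by (induction r) simp_all

text \<open>\<open>continue\<close> recurses at its last step; conditioning on the first observation
  needs the first step peeled off instead.\<close>

lemma continue_Suc_front:
  "continue X \<pi> k v (Suc r) \<omega> =
     continue X \<pi> (Suc k) (v(k := (case \<pi> k v of (j, c) \<Rightarrow> X j c \<omega>))) r \<omega>"
proof (induction r)
  case (Suc r)
  show ?case
    unfolding continue.simps(2)[of _ _ _ _ "Suc r"] Suc.IH by (simp only: continue.simps add_Suc add_Suc_right)
qed simp

lemma continue_outside: "i < k \<or> k + r \<le> i \<Longrightarrow> continue X \<pi> k v r \<omega> i = v i"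
  by (induction r) auto

lemma continue_extensional:
  "v \<in> extensional {..<k} \<Longrightarrow> continue X \<pi> k v r \<omega> \<in> extensional {..<k + r}"
  by (auto simp: extensional_def continue_outside)

lemma observed_extensional: "observed X \<pi> k \<omega> \<in> extensional {..<k}"
  using continue_extensional[of "\<lambda>_. undefined" 0 X \<pi> k \<omega>] by (simp add: observed_eq_continue)

text \<open>A full history contains all shorter ones. This matches runs with the
  \<open>restrict v {..<k}\<close> in \<open>adaptive_policy\<close>, which speaks of a single
  history \<open>v\<close>.\<close>

lemma observed_eq_restrict:
  assumes "k \<le> n" shows "observed X \<pi> k \<omega> = restrict (observed X \<pi> n \<omega>) {..<k}"
  using assms
proof (induction n rule: dec_induct)
  case base
  then show ?case by (rule extensional_restrict[OF observed_extensional, symmetric])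
next
  case (step n)
  then show ?case by (auto simp: restrict_def fun_eq_iff)
qed

lemma adaptive_policy_valid:
  assumes "adaptive_policy n q \<pi>" and "k < n" and "v \<in> extensional {..<k}"
  shows "fst (\<pi> k v) < n" and "snd (\<pi> k v) < q (fst (\<pi> k v))"
proof -
  have v: "restrict v {..<k} = v"
    using assms(3) by (simp add: extensional_restrict)
  have "bij_betw (\<lambda>k. fst (\<pi> k (restrict v {..<k}))) {..<n} {..<n}"
    using assms(1) by (simp add: adaptive_policy_def)
  then show "fst (\<pi> k v) < n"
    using bij_betw_apply[of _ _ _ k] assms(2) v by fastforce
  have "case \<pi> k (restrict v {..<k}) of (j, c) \<Rightarrow> c < q j"
    using assms by (simp add: adaptive_policy_def)
  then show "snd (\<pi> k v) < q (fst (\<pi> k v))"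
    by (simp add: v split_beta)
qed

lemma adaptive_policy_fresh:
  assumes "adaptive_policy n q \<pi>" and "i < k" and "k < n" and "v \<in> extensional {..<k}"
  shows "fst (\<pi> k v) \<noteq> fst (\<pi> i (restrict v {..<i}))"
proof
  assume eq: "fst (\<pi> k v) = fst (\<pi> i (restrict v {..<i}))"
  have v: "restrict v {..<k} = v"
    using assms(4) by (simp add: extensional_restrict)
  have "inj_on (\<lambda>k. fst (\<pi> k (restrict v {..<k}))) {..<n}"
    using assms(1) by (auto simp: adaptive_policy_def bij_betw_def)
  from inj_onD[OF this, of k i] show False
    using eq v assms(2,3) by auto
qed

text \<open>No request is handled twice, so from the history \<open>v\<close> onward only requests
  not yet handled are read. This serves both to pass to projections on the product space and to
  overwrite the data of a handled request.\<close>

lemma continue_cong: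
  assumes "adaptive_policy n q \<pi>" and "v \<in> extensional {..<k}" and "k + r \<le> n"
    and "\<And>j c. j < n \<Longrightarrow> c < q j \<Longrightarrow> j \<notin> (\<lambda>i. fst (\<pi> i (restrict v {..<i}))) ` {..<k} \<Longrightarrow>
      X j c \<omega> = Y j c \<omega>'"
  shows "continue X \<pi> k v r \<omega> = continue Y \<pi> k v r \<omega>'"
  using assms(3)
proof (induction r)
  case (Suc r)
  define h where "h = continue X \<pi> k v r \<omega>"
  have h: "continue Y \<pi> k v r \<omega>' = h"
    using Suc by (simp add: h_def)
  have ext: "h \<in> extensional {..<k + r}"
    unfolding h_def by (intro continue_extensional assms)
  have res: "restrict h {..<i} = restrict v {..<i}" if "i < k" for i
    using that by (auto simp: restrict_def fun_eq_iff h_def continue_outside)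
  have fresh: "fst (\<pi> (k + r) h) \<noteq> fst (\<pi> i (restrict v {..<i}))" if "i < k" for i
    using adaptive_policy_fresh[OF assms(1) _ _ ext, of i] res[OF that] that Suc.prems by auto
  have "X (fst (\<pi> (k + r) h)) (snd (\<pi> (k + r) h)) \<omega> = Y (fst (\<pi> (k + r) h)) (snd (\<pi> (k + r) h)) \<omega>'"
    using adaptive_policy_valid[OF assms(1) _ ext] Suc.prems fresh
    by (intro assms(4)) auto
  then show ?case
    by (simp add: h h_def[symmetric] split_beta)
qed simp

lemma measurable_continue:
  assumes \<pi>: "adaptive_policy n q \<pi>" and v: "v \<in> extensional {..<k}" and "k + r \<le> n"
    and X: "\<And>j c. j < n \<Longrightarrow> c < q j \<Longrightarrow> X j c \<in> borel_measurable N"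
  shows "continue X \<pi> k v r \<in> N \<rightarrow>\<^sub>M PiM {..<k + r} (\<lambda>_. borel)"
  using assms(3)
proof (induction r)
  case 0
  have "v \<in> space (PiM {..<k} (\<lambda>_. borel))"
    using v by (simp add: space_PiM PiE_def)
  then show ?case by simp
next
  case (Suc r)
  let ?h = "continue X \<pi> k v r" and ?A = "SIGMA j:{..<n}. {..<q j}"
  have h: "?h \<in> N \<rightarrow>\<^sub>M PiM {..<k + r} (\<lambda>_. borel)"
    using Suc by simp
  have "\<pi> (k + r) \<in> PiM {..<k + r} (\<lambda>_. borel) \<rightarrow>\<^sub>M count_space UNIV"
    using \<pi> Suc.prems by (simp add: adaptive_policy_def)
  from measurable_compose[OF h this]
  have "(\<lambda>\<omega>. \<pi> (k + r) (?h \<omega>)) \<in> N \<rightarrow>\<^sub>M count_space UNIV" .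
  \<comment> \<open>Measurability of \<open>X j c\<close> is known only for valid actions, so the
    choice is regarded as a map into the finite set \<open>?A\<close>.\<close>
  moreover have "\<pi> (k + r) (?h \<omega>) \<in> ?A" for \<omega>
    using adaptive_policy_valid[OF \<pi> _ continue_extensional[OF v], of r X \<pi> \<omega>] Suc.prems
    by (cases "\<pi> (k + r) (?h \<omega>)") simp
  ultimately have a: "(\<lambda>\<omega>. \<pi> (k + r) (?h \<omega>)) \<in> N \<rightarrow>\<^sub>M count_space ?A"
    using measurable_count_space_extend[OF subset_UNIV, of "\<lambda>\<omega>. \<pi> (k + r) (?h \<omega>)" N ?A] by blast
  have "(\<lambda>\<omega>. case \<pi> (k + r) (?h \<omega>) of (j, c) \<Rightarrow> X j c \<omega>) \<in> borel_measurable N"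
    by (rule measurable_compose_countable'[OF _ a]) (auto intro!: X)
  with h show ?case
    unfolding continue.simps by (intro measurable_fun_upd[where J = "{..<k + r}"]) auto
qed

lemma measurable_observed:
  assumes "adaptive_policy n q \<pi>" and "k \<le> n"
    and "\<And>j c. j < n \<Longrightarrow> c < q j \<Longrightarrow> X j c \<in> borel_measurable N"
  shows "observed X \<pi> k \<in> N \<rightarrow>\<^sub>M PiM {..<k} (\<lambda>_. borel)"
proof -
  have "observed X \<pi> k = continue X \<pi> 0 (\<lambda>_. undefined) k"
    by (simp add: fun_eq_iff observed_eq_continue)
  then show ?thesis
    using measurable_continue[OF assms(1), of "\<lambda>_. undefined" 0 k X N] assms by simp
qed

text \<open>Every step draws its own scenario, whereas a run uses one scenario throughout. For
  adaptive policies the two expectations agree by independence.\<close>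

primrec tree_integral ::
  "'w measure \<Rightarrow> (nat \<Rightarrow> nat \<Rightarrow> 'w \<Rightarrow> real ^ 'm) \<Rightarrow> 'm::finite policy \<Rightarrow>
    ((nat \<Rightarrow> real ^ 'm) \<Rightarrow> ennreal) \<Rightarrow> nat \<Rightarrow> nat \<Rightarrow> (nat \<Rightarrow> real ^ 'm) \<Rightarrow> ennreal" where
  "tree_integral M X \<pi> G 0 k v = G v"
| "tree_integral M X \<pi> G (Suc r) k v =
     (case \<pi> k v of (j, c) \<Rightarrow> \<integral>\<^sup>+\<omega>. tree_integral M X \<pi> G r (Suc k) (v(k := X j c \<omega>)) \<partial>M)"

context config_balancing
begin

lemma measurable_X[measurable]:
  assumes "j < n" "c < q j" shows "X j c \<in> borel_measurable M"
proof -
  have "(\<lambda>\<omega>. \<lambda>c\<in>{..<q j}. X j c \<omega>) \<in> M \<rightarrow>\<^sub>M PiM {..<q j} (\<lambda>_. borel)"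
    using indep assms by (simp add: indep_vars_def)
  from measurable_compose[OF this measurable_component_singleton, of c] show ?thesis
    using assms by simp
qed

text \<open>
  Given the history, the next request is deterministic and is never inspected again. Hence its
  vector may be sampled independently of all later ones, which peels one integral off the expectation.
\<close>

lemma nn_integral_continue:
  assumes \<pi>: "adaptive_policy n q \<pi>" and G: "G \<in> borel_measurable (PiM {..<n} (\<lambda>_. borel))"
    and "v \<in> extensional {..<k}" and "k + r = n"
  shows "(\<integral>\<^sup>+\<omega>. G (continue X \<pi> k v r \<omega>) \<partial>M) = tree_integral M X \<pi> G r k v"
  using assms(3,4)
proof (induction r arbitrary: k v)
  case 0
  then show ?case by (simp add: emeasure_space_1)
next
  case (Suc r)
  define j c where "j = fst (\<pi> k v)" and "c = snd (\<pi> k v)"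
  have jc: "\<pi> k v = (j, c)" "j < n" "c < q j"
    using adaptive_policy_valid[OF \<pi> _ Suc.prems(1)] Suc.prems(2) by (auto simp: j_def c_def)
  \<comment> \<open>\<open>P\<close> gives the coordinates of the product space, where the data of a
    single request can be overwritten; \<open>D j\<close> collects all vectors of request
    \<open>j\<close>, the unit of independence.\<close>
  define P :: "nat \<Rightarrow> nat \<Rightarrow> (nat \<Rightarrow> nat \<Rightarrow> real ^ 'm) \<Rightarrow> real ^ 'm" where "P j c x = x j c" for j c x
  define D where "D j \<omega> = (\<lambda>c\<in>{..<q j}. X j c \<omega>)" for j \<omega>
  let ?N = "\<lambda>j. PiM {..<q j} (\<lambda>_. borel :: (real ^ 'm) measure)"
  have indep': "indep_vars ?N D {..<n}"
    using indep unfolding D_def[abs_def] .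
  let ?D = "\<lambda>\<omega>. \<lambda>j\<in>{..<n}. D j \<omega>"
  have to_P: "continue X \<pi> k' v' r' \<omega> = continue P \<pi> k' v' r' (?D \<omega>)"
    if "v' \<in> extensional {..<k'}" "k' + r' \<le> n" for k' v' r' \<omega>
    using that by (intro continue_cong[OF \<pi>]) (auto simp: P_def D_def)
  have P: "P j c \<in> borel_measurable (PiM {..<n} ?N)" if "j < n" "c < q j" for j c
    unfolding P_def using that
    by (intro measurable_compose[OF measurable_component_singleton[of j] measurable_component_singleton[of c]]) auto
  have F: "(\<lambda>x. G (continue P \<pi> k v (Suc r) x)) \<in> borel_measurable (PiM {..<n} ?N)"
  proof (rule measurable_compose[OF _ G])
    show "continue P \<pi> k v (Suc r) \<in> PiM {..<n} ?N \<rightarrow>\<^sub>M PiM {..<n} (\<lambda>_. borel)"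
      using measurable_continue[OF \<pi> Suc.prems(1), of "Suc r" P] P Suc.prems(2) by simp
  qed
  have ext: "v(k := y) \<in> extensional {..<Suc k}" for y
    using Suc.prems(1) by (auto simp: extensional_def)
  \<comment> \<open>Request \<open>j\<close> is handled in step \<open>k\<close>, so the later steps
    never read its coordinate.\<close>
  have forget: "continue P \<pi> (Suc k) (v(k := y)) r (x(j := z)) = continue P \<pi> (Suc k) (v(k := y)) r x" for x y z
  proof (rule continue_cong[OF \<pi> ext])
    have "restrict (v(k := y)) {..<k} = v"
      using Suc.prems(1) by (auto simp: extensional_def restrict_def fun_eq_iff)
    then have "j \<in> (\<lambda>i. fst (\<pi> i (restrict (v(k := y)) {..<i}))) ` {..<Suc k}"
      using jc by (intro image_eqI[of _ _ k]) auto
    then show "P j' c' (x(j := z)) = P j' c' x"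
      if "j' \<notin> (\<lambda>i. fst (\<pi> i (restrict (v(k := y)) {..<i}))) ` {..<Suc k}" for j' c'
      using that by (auto simp: P_def)
  qed (use Suc.prems in auto)
  have "(\<integral>\<^sup>+\<omega>. G (continue X \<pi> k v (Suc r) \<omega>) \<partial>M) = (\<integral>\<^sup>+\<omega>. G (continue P \<pi> k v (Suc r) (?D \<omega>)) \<partial>M)"
    using Suc.prems by (intro nn_integral_cong arg_cong[where f = G] to_P) auto
  also have "\<dots> = (\<integral>\<^sup>+\<omega>. \<integral>\<^sup>+\<omega>'. G (continue P \<pi> k v (Suc r) ((?D \<omega>')(j := D j \<omega>))) \<partial>M \<partial>M)"
    by (rule nn_integral_indep_resample[OF indep' _ _ F]) (use jc in auto)
  also have "\<dots> = (\<integral>\<^sup>+\<omega>. \<integral>\<^sup>+\<omega>'. G (continue X \<pi> (Suc k) (v(k := X j c \<omega>)) r \<omega>') \<partial>M \<partial>M)"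
  proof (intro nn_integral_cong arg_cong[where f = G])
    fix \<omega> \<omega>'
    \<comment> \<open>The first step reads its vector from \<omega>, the later ones read only
      \<omega>'.\<close>
    have "continue P \<pi> k v (Suc r) ((?D \<omega>')(j := D j \<omega>)) = continue P \<pi> (Suc k) (v(k := X j c \<omega>)) r ((?D \<omega>')(j := D j \<omega>))"
      unfolding continue_Suc_front using jc by (simp add: P_def D_def)
    also have "\<dots> = continue X \<pi> (Suc k) (v(k := X j c \<omega>)) r \<omega>'"
      unfolding forget using Suc.prems by (intro to_P[symmetric] ext) auto
    finally show "continue P \<pi> k v (Suc r) ((?D \<omega>')(j := D j \<omega>)) = continue X \<pi> (Suc k) (v(k := X j c \<omega>)) r \<omega>'" .
  qed
  also have "\<dots> = (\<integral>\<^sup>+\<omega>. tree_integral M X \<pi> G r (Suc k) (v(k := X j c \<omega>)) \<partial>M)"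
    using Suc.prems by (intro nn_integral_cong Suc.IH ext) auto
  finally show ?case
    by (simp only: tree_integral.simps jc(1) prod.case)
qed

lemma nn_integral_observed:
  assumes "adaptive_policy n q \<pi>" and "G \<in> borel_measurable (PiM {..<n} (\<lambda>_. borel))"
  shows "(\<integral>\<^sup>+\<omega>. G (observed X \<pi> n \<omega>) \<partial>M) = tree_integral M X \<pi> G n 0 (\<lambda>_. undefined)"
  using nn_integral_continue[OF assms, of "\<lambda>_. undefined" 0 n] by (simp add: observed_eq_continue)

end

subsection \<open>Loads as functions of the observed history\<close>

definition max_load :: "real ^ 'm::finite \<Rightarrow> real" where
  "max_load y = (MAX i. y $ i)"

lemma max_load_ge: "y $ i \<le> max_load y"
  by (simp add: max_load_def)

lemma max_load_le_iff: "max_load y \<le> b \<longleftrightarrow> (\<forall>i. y $ i \<le> b)"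
  by (simp add: max_load_def)

lemma max_load_mono: "y \<le> z \<Longrightarrow> max_load y \<le> max_load z"
  unfolding max_load_le_iff using max_load_ge order_trans by (fastforce simp: less_eq_vec_def)

lemma max_load_zero[simp]: "max_load 0 = 0"
  by (simp add: max_load_def)

lemma max_load_nonneg: "0 \<le> y \<Longrightarrow> 0 \<le> max_load y"
  using max_load_mono[of 0 y] by simp

lemma max_load_add_le: "max_load (y + z) \<le> max_load y + max_load z"
  unfolding max_load_le_iff by (auto intro!: add_mono max_load_ge)

lemma borel_measurable_max_load[measurable]: "max_load \<in> borel_measurable borel"
  unfolding max_load_def[abs_def] by (intro borel_measurable_Max) auto

text \<open>\<open>ennreal\<close> clips negative numbers at 0, so dropping a negative summand only
  enlarges the bound. Signs are arbitrary because the lemma is applied to maximum loads of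
  differences \<open>y - l\<close>.\<close>

lemma ennreal_add_le: "ennreal (a + b) \<le> ennreal a + ennreal b"
proof (cases "0 \<le> a \<and> 0 \<le> b")
  case False
  then have "ennreal (a + b) \<le> ennreal a \<or> ennreal (a + b) \<le> ennreal b"
    by (auto intro: ennreal_leI)
  then show ?thesis
    by (meson add_increasing add_increasing2 zero_le)
qed simp

text \<open>Each request is handled in exactly one step, which makes the description in
  \<open>selected\<close> unique.\<close>

lemma
  assumes \<pi>: "adaptive_policy n q \<pi>"
  shows bij_betw_chosen: "bij_betw (\<lambda>k. fst (\<pi> k (observed X \<pi> k \<omega>))) {..<n} {..<n}"
    and selected_chosen: "k < n \<Longrightarrow>
      selected n X \<pi> (fst (\<pi> k (observed X \<pi> k \<omega>))) \<omega> = snd (\<pi> k (observed X \<pi> k \<omega>))"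
proof -
  have "bij_betw (\<lambda>k. fst (\<pi> k (restrict (observed X \<pi> n \<omega>) {..<k}))) {..<n} {..<n}"
    using \<pi> unfolding adaptive_policy_def by blast
  also have "?this \<longleftrightarrow> bij_betw (\<lambda>k. fst (\<pi> k (observed X \<pi> k \<omega>))) {..<n} {..<n}"
    by (intro bij_betw_cong) (metis observed_eq_restrict less_imp_le lessThan_iff)
  finally show bij: "bij_betw (\<lambda>k. fst (\<pi> k (observed X \<pi> k \<omega>))) {..<n} {..<n}" .
  show "selected n X \<pi> (fst (\<pi> k (observed X \<pi> k \<omega>))) \<omega> = snd (\<pi> k (observed X \<pi> k \<omega>))" if "k < n"
    unfolding selected_def
  proof (rule the_equality)
    show "\<exists>k'<n. \<pi> k' (observed X \<pi> k' \<omega>) = (fst (\<pi> k (observed X \<pi> k \<omega>)), snd (\<pi> k (observed X \<pi> k \<omega>)))"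
      using that by auto
  next
    fix c assume "\<exists>k'<n. \<pi> k' (observed X \<pi> k' \<omega>) = (fst (\<pi> k (observed X \<pi> k \<omega>)), c)"
    then obtain k' where k': "k' < n" "\<pi> k' (observed X \<pi> k' \<omega>) = (fst (\<pi> k (observed X \<pi> k \<omega>)), c)"
      by blast
    then have "k' = k"
      using inj_onD[OF bij_betw_imp_inj_on[OF bij], of k' k] that by simp
    with k' show "c = snd (\<pi> k (observed X \<pi> k \<omega>))" by (metis snd_conv)
  qed
qed

lemma observed_nth:
  fixes X :: "nat \<Rightarrow> nat \<Rightarrow> 'w \<Rightarrow> real ^ 'm::finite" and \<omega> :: 'w
  assumes "adaptive_policy n q \<pi>" and "k < n"
  defines "j \<equiv> fst (\<pi> k (observed X \<pi> k \<omega>))"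
  shows "observed X \<pi> n \<omega> k = X j (selected n X \<pi> j \<omega>) \<omega>"
proof -
  have "observed X \<pi> n \<omega> k = observed X \<pi> (Suc k) \<omega> k"
    using assms(2) by (subst observed_eq_restrict[of "Suc k" n]) auto
  then show ?thesis
    using selected_chosen[OF assms(1,2), of X \<omega>] by (simp add: j_def split_beta)
qed

lemma sum_selected:
  fixes f :: "real ^ 'm::finite \<Rightarrow> 'b::comm_monoid_add"
  assumes "adaptive_policy n q \<pi>"
  shows "(\<Sum>j<n. f (X j (selected n X \<pi> j \<omega>) \<omega>)) = (\<Sum>k<n. f (observed X \<pi> n \<omega> k))"
  using sum.reindex_bij_betw[OF bij_betw_chosen[OF assms, of X \<omega>],
      of "\<lambda>j. f (X j (selected n X \<pi> j \<omega>) \<omega>)"]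
  by (simp add: observed_nth[OF assms])

text \<open>\<open>selected\<close> is a definite description with no evident measurability. The sum
  replaces it by finitely many terms, each measurable through the history.\<close>

lemma selected_eq_sum:
  fixes f :: "real ^ 'm::finite \<Rightarrow> 'b::comm_monoid_add"
  assumes \<pi>: "adaptive_policy n q \<pi>" and "j < n"
  shows "f (X j (selected n X \<pi> j \<omega>) \<omega>) =
    (\<Sum>k<n. if fst (\<pi> k (observed X \<pi> k \<omega>)) = j then f (observed X \<pi> n \<omega> k) else 0)"
proof -
  note bij = bij_betw_chosen[OF \<pi>, of X \<omega>]
  have "j \<in> (\<lambda>k. fst (\<pi> k (observed X \<pi> k \<omega>))) ` {..<n}"
    using \<open>j < n\<close> unfolding bij_betw_imp_surj_on[OF bij] by simp
  then obtain k where k: "k < n" "fst (\<pi> k (observed X \<pi> k \<omega>)) = j"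
    by (elim imageE) auto
  have uniq: "fst (\<pi> i (observed X \<pi> i \<omega>)) = j \<longleftrightarrow> i = k" if "i < n" for i
    using inj_on_eq_iff[OF bij_betw_imp_inj_on[OF bij], of i k] k that by simp
  have "(\<Sum>i<n. if fst (\<pi> i (observed X \<pi> i \<omega>)) = j then f (observed X \<pi> n \<omega> i) else 0) =
    (\<Sum>i<n. if i = k then f (observed X \<pi> n \<omega> i) else 0)"
    by (intro sum.cong refl) (simp add: uniq)
  also have "\<dots> = f (observed X \<pi> n \<omega> k)"
    using k by simp
  finally show ?thesis
    using observed_nth[OF \<pi> k(1), of X \<omega>] k by simp
qed

lemma makespan_eq_observed:
  assumes "adaptive_policy n q \<pi>"
  shows "makespan n X \<pi> \<omega> = max_load (\<Sum>k<n. observed X \<pi> n \<omega> k)"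
  unfolding makespan_def max_load_def
  by (simp add: sum_selected[OF assms, where f = "\<lambda>y. y $ _"])

lemma (in prob_space) nn_integral_ge_const:
  assumes "\<And>\<omega>. \<omega> \<in> space M \<Longrightarrow> b \<le> f \<omega>"
  shows "b \<le> (\<integral>\<^sup>+\<omega>. f \<omega> \<partial>M)"
  using nn_integral_mono[of M "\<lambda>_. b" f] assms by (simp add: emeasure_space_1)

context config_balancing
begin

lemma X_nonneg: "j < n \<Longrightarrow> c < q j \<Longrightarrow> \<omega> \<in> space M \<Longrightarrow> 0 \<le> X j c \<omega>"
  using nonneg by (simp add: less_eq_vec_def)

lemma expected_makespan_eq_tree_integral:
  assumes "adaptive_policy n q \<pi>"
  shows "expected_makespan M n X \<pi> =
    tree_integral M X \<pi> (\<lambda>v. ennreal (max_load (\<Sum>k<n. v k))) n 0 (\<lambda>_. undefined)"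
  unfolding expected_makespan_def makespan_eq_observed[OF assms]
  by (rule nn_integral_observed[OF assms]) measurable

lemma sum_expected_selected_eq_tree_integral:
  assumes \<pi>: "adaptive_policy n q \<pi>" and [measurable]: "f \<in> borel_measurable borel"
  shows "(\<Sum>j<n. \<integral>\<^sup>+\<omega>. f (X j (selected n X \<pi> j \<omega>) \<omega>) \<partial>M) =
    tree_integral M X \<pi> (\<lambda>v. \<Sum>k<n. f (v k)) n 0 (\<lambda>_. undefined)"
proof -
  have obs: "observed X \<pi> k \<in> M \<rightarrow>\<^sub>M PiM {..<k} (\<lambda>_. borel)" if "k \<le> n" for k
    using that by (intro measurable_observed[OF \<pi>]) auto
  have comp: "(\<lambda>\<omega>. f (observed X \<pi> n \<omega> k)) \<in> borel_measurable M" if "k < n" for k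
    using that by (intro measurable_compose[OF measurable_compose[OF obs measurable_component_singleton]]) auto
  have [measurable]: "(\<lambda>\<omega>. fst (\<pi> k (observed X \<pi> k \<omega>))) \<in> M \<rightarrow>\<^sub>M count_space UNIV" if "k < n" for k
  proof -
    have "\<pi> k \<in> PiM {..<k} (\<lambda>_. borel) \<rightarrow>\<^sub>M count_space UNIV"
      using \<pi> that by (simp add: adaptive_policy_def)
    from measurable_compose[OF measurable_compose[OF obs this], of fst] show ?thesis
      using that by simp
  qed
  have "(\<lambda>\<omega>. f (X j (selected n X \<pi> j \<omega>) \<omega>)) \<in> borel_measurable M" if "j < n" for j
    unfolding selected_eq_sum[OF \<pi> that]
  proof (rule borel_measurable_sum)
    fix k assume "k \<in> {..<n}"
    then have k: "k < n" by simp
    note [measurable] = comp[OF k]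
    show "(\<lambda>\<omega>. if fst (\<pi> k (observed X \<pi> k \<omega>)) = j then f (observed X \<pi> n \<omega> k) else 0) \<in> borel_measurable M"
      using k by measurable
  qed
  then have "(\<Sum>j<n. \<integral>\<^sup>+\<omega>. f (X j (selected n X \<pi> j \<omega>) \<omega>) \<partial>M) =
    (\<integral>\<^sup>+\<omega>. (\<Sum>j<n. f (X j (selected n X \<pi> j \<omega>) \<omega>)) \<partial>M)"
    by (intro nn_integral_sum[symmetric]) auto
  also have "\<dots> = (\<integral>\<^sup>+\<omega>. (\<Sum>k<n. f (observed X \<pi> n \<omega> k)) \<partial>M)"
    by (simp add: sum_selected[OF \<pi>])
  also have "\<dots> = tree_integral M X \<pi> (\<lambda>v. \<Sum>k<n. f (v k)) n 0 (\<lambda>_. undefined)"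
    by (rule nn_integral_observed[OF \<pi>]) measurable
  finally show ?thesis .
qed

subsection \<open>The value function\<close>

definition actions :: "nat set \<Rightarrow> (nat \<times> nat) set" where
  "actions J = (SIGMA j:J. {..<q j})"

text \<open>
  Bellman's recursion for the least expected makespan when the requests \<open>J\<close> remain and the
  load is \<open>l\<close>. The counter \<open>r\<close> is meant to be \<open>card J\<close>.
\<close>

primrec opt_value :: "nat \<Rightarrow> nat set \<Rightarrow> real ^ 'm \<Rightarrow> ennreal" where
  "opt_value 0 J l = ennreal (max_load l)"
| "opt_value (Suc r) J l =
     (INF a\<in>actions J. \<integral>\<^sup>+\<omega>. opt_value r (J - {fst a}) (l + X (fst a) (snd a) \<omega>) \<partial>M)"

definition action_value :: "nat \<Rightarrow> nat set \<Rightarrow> real ^ 'm \<Rightarrow> nat \<times> nat \<Rightarrow> ennreal" where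
  "action_value r J l a = (\<integral>\<^sup>+\<omega>. opt_value r (J - {fst a}) (l + X (fst a) (snd a) \<omega>) \<partial>M)"

lemma opt_value_Suc: "opt_value (Suc r) J l = (INF a\<in>actions J. action_value r J l a)"
  by (simp add: action_value_def)

declare opt_value.simps(2)[simp del]

lemma actions_iff: "a \<in> actions J \<longleftrightarrow> fst a \<in> J \<and> snd a < q (fst a)"
  by (cases a) (simp add: actions_def)

lemma actions_D:
  assumes "J \<subseteq> {..<n}" "a \<in> actions J"
  shows "fst a < n" "snd a < q (fst a)"
  using assms by (auto simp: actions_iff)

lemma X_action_nonneg:
  "J \<subseteq> {..<n} \<Longrightarrow> a \<in> actions J \<Longrightarrow> \<omega> \<in> space M \<Longrightarrow> 0 \<le> X (fst a) (snd a) \<omega>"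
  by (intro X_nonneg) (auto simp: actions_iff)

lemma opt_value_le_action_value: "a \<in> actions J \<Longrightarrow> opt_value (Suc r) J l \<le> action_value r J l a"
  unfolding opt_value_Suc by (rule INF_lower)

text \<open>Only finitely many actions compete, and \<open>config_exists\<close> supplies
  configuration 0 for each remaining request.\<close>

lemma opt_value_attained:
  assumes "J \<subseteq> {..<n}" "J \<noteq> {}"
  obtains a where "a \<in> actions J" "action_value r J l a = opt_value (Suc r) J l"
proof -
  have fin: "finite (actions J)"
    unfolding actions_def using assms by (auto intro: finite_subset)
  obtain j where j: "j \<in> J" using assms by auto
  with assms config_exists[of j] have "(j, 0) \<in> actions J"
    by (auto simp: actions_iff)
  then have "action_value r J l ` actions J \<noteq> {}" by auto
  with fin have "Inf (action_value r J l ` actions J) \<in> action_value r J l ` actions J"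
    by (metis Min_Inf Min_in finite_imageI)
  then show ?thesis
    using that unfolding opt_value_Suc by auto
qed

lemma opt_value_mono: "l \<le> l' \<Longrightarrow> opt_value r J l \<le> opt_value r J l'"
proof (induction r arbitrary: J l l')
  case 0
  then show ?case by (simp add: ennreal_leI max_load_mono)
next
  case (Suc r)
  then show ?case
    unfolding opt_value_Suc action_value_def
    by (intro INF_mono'  nn_integral_mono Suc.IH) simp
qed

lemma borel_measurable_opt_value[measurable]:
  "J \<subseteq> {..<n} \<Longrightarrow> opt_value r J \<in> borel_measurable borel"
proof (induction r arbitrary: J)
  case 0
  then show ?case by simp
next
  case (Suc r)
  have "(\<lambda>l. \<integral>\<^sup>+\<omega>. opt_value r (J - {fst a}) (l + X (fst a) (snd a) \<omega>) \<partial>M) \<in> borel_measurable borel"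
    if "a \<in> actions J" for a
  proof -
    have [measurable]: "X (fst a) (snd a) \<in> borel_measurable M"
      using actions_D[OF Suc.prems that] by auto
    have [measurable]: "opt_value r (J - {fst a}) \<in> borel_measurable borel"
      using Suc by blast
    show ?thesis by measurable
  qed
  then show ?case
    unfolding opt_value_Suc[abs_def] action_value_def
    by (intro borel_measurable_INF) (auto intro: countable_subset)
qed

lemma borel_measurable_action_value:
  assumes "J \<subseteq> {..<n}" "a \<in> actions J"
  shows "(\<lambda>l. action_value r J l a) \<in> borel_measurable borel"
proof -
  have [measurable]: "X (fst a) (snd a) \<in> borel_measurable M"
    using actions_D[OF assms] by auto
  have [measurable]: "opt_value r (J - {fst a}) \<in> borel_measurable borel"
    using assms by (intro borel_measurable_opt_value) auto
  show ?thesis unfolding action_value_def by measurable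
qed

text \<open>Vectors are nonnegative, so the load already present survives to the end under every
  choice.\<close>

lemma max_load_le_opt_value: "J \<subseteq> {..<n} \<Longrightarrow> ennreal (max_load l) \<le> opt_value r J l"
proof (induction r arbitrary: J l)
  case 0
  then show ?case by simp
next
  case (Suc r)
  show ?case
    unfolding opt_value_Suc action_value_def
  proof (intro INF_greatest nn_integral_ge_const)
    fix a \<omega> assume a: "a \<in> actions J" and \<omega>: "\<omega> \<in> space M"
    have "ennreal (max_load l) \<le> ennreal (max_load (l + X (fst a) (snd a) \<omega>))"
      using X_action_nonneg[OF Suc.prems a \<omega>] by (intro ennreal_leI max_load_mono) simp
    also have "\<dots> \<le> opt_value r (J - {fst a}) (l + X (fst a) (snd a) \<omega>)"
      using Suc by blast
    finally show "ennreal (max_load l) \<le> opt_value r (J - {fst a}) (l + X (fst a) (snd a) \<omega>)" .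
  qed
qed

text \<open>Any plan for \<open>J\<close> also serves \<open>J - {j}\<close>: skip the step that
  handles \<open>j\<close>. Omitting its vector only lowers the load, and \<open>opt_value\<close>
  is monotone in the load.\<close>

lemma opt_value_remove:
  "J \<subseteq> {..<n} \<Longrightarrow> j \<in> J \<Longrightarrow> opt_value r (J - {j}) l \<le> opt_value (Suc r) J l"
proof (induction r arbitrary: J l)
  case 0
  then show ?case using max_load_le_opt_value[of J l "Suc 0"] by simp
next
  case (Suc r)
  show ?case
    unfolding opt_value_Suc[of "Suc r"]
  proof (rule INF_greatest)
    fix a assume a: "a \<in> actions J"
    show "opt_value (Suc r) (J - {j}) l \<le> action_value (Suc r) J l a"
    proof (cases "fst a = j")
      case True
      then show ?thesis
        unfolding action_value_def
        using X_action_nonneg[OF Suc.prems(1) a] by (intro nn_integral_ge_const) (auto intro!: opt_value_mono)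
    next
      case False
      then have "opt_value (Suc r) (J - {j}) l \<le> action_value r (J - {j}) l a"
        using a by (intro opt_value_le_action_value) (auto simp: actions_iff)
      also have "\<dots> \<le> action_value (Suc r) J l a"
        unfolding action_value_def
      proof (rule nn_integral_mono)
        fix \<omega>
        show "opt_value r (J - {j} - {fst a}) (l + X (fst a) (snd a) \<omega>)
          \<le> opt_value (Suc r) (J - {fst a}) (l + X (fst a) (snd a) \<omega>)"
          using Suc.IH[of "J - {fst a}"] Suc.prems False by (auto simp: Diff_insert2[symmetric] insert_commute)
      qed
      finally show ?thesis .
    qed
  qed
qed

text \<open>The subtracted image is the set of requests handled along \<open>v\<close>, and the
  policy's next choice is one candidate in the infimum of Bellman's recursion.\<close>

lemma opt_value_le_tree_integral:
  assumes \<pi>: "adaptive_policy n q \<pi>"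
    and "v \<in> extensional {..<k}" and "k + r = n"
  shows "opt_value r ({..<n} - (\<lambda>i. fst (\<pi> i (restrict v {..<i}))) ` {..<k}) (\<Sum>i<k. v i) \<le>
    tree_integral M X \<pi> (\<lambda>v. ennreal (max_load (\<Sum>i<n. v i))) r k v"
  using assms(2,3)
proof (induction r arbitrary: k v)
  case 0
  then show ?case by simp
next
  case (Suc r)
  let ?J = "{..<n} - (\<lambda>i. fst (\<pi> i (restrict v {..<i}))) ` {..<k}"
  have k: "k < n" using Suc.prems by simp
  have a: "\<pi> k v \<in> actions ?J"
    using adaptive_policy_valid[OF \<pi> k Suc.prems(1)] adaptive_policy_fresh[OF \<pi> _ k Suc.prems(1)]
    by (auto simp: actions_iff)
  have "opt_value (Suc r) ?J (\<Sum>i<k. v i) \<le> action_value r ?J (\<Sum>i<k. v i) (\<pi> k v)"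
    by (rule opt_value_le_action_value[OF a])
  also have "\<dots> \<le> (\<integral>\<^sup>+\<omega>. tree_integral M X \<pi> (\<lambda>v. ennreal (max_load (\<Sum>i<n. v i))) r (Suc k)
      (v(k := X (fst (\<pi> k v)) (snd (\<pi> k v)) \<omega>)) \<partial>M)"
    unfolding action_value_def
  proof (rule nn_integral_mono)
    fix \<omega>
    let ?v = "v(k := X (fst (\<pi> k v)) (snd (\<pi> k v)) \<omega>)"
    have "restrict ?v {..<i} = restrict v {..<i}" if "i < Suc k" for i
      using that by (auto simp: restrict_def fun_eq_iff)
    moreover have "restrict v {..<k} = v"
      using Suc.prems(1) by (rule extensional_restrict)
    ultimately have "{..<n} - (\<lambda>i. fst (\<pi> i (restrict ?v {..<i}))) ` {..<Suc k} = ?J - {fst (\<pi> k v)}"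
      by (auto simp: lessThan_Suc)
    moreover have "?v \<in> extensional {..<Suc k}"
      using Suc.prems(1) by (auto simp: extensional_def)
    ultimately have "opt_value r (?J - {fst (\<pi> k v)}) (\<Sum>i<Suc k. ?v i)
      \<le> tree_integral M X \<pi> (\<lambda>v. ennreal (max_load (\<Sum>i<n. v i))) r (Suc k) ?v"
      using Suc.IH[of ?v "Suc k"] Suc.prems(2) by (simp only: add_Suc add_Suc_right)
    moreover have "(\<Sum>i<Suc k. ?v i) = (\<Sum>i<k. v i) + X (fst (\<pi> k v)) (snd (\<pi> k v)) \<omega>"
      by simp
    ultimately show "opt_value r (?J - {fst (\<pi> k v)}) ((\<Sum>i<k. v i) + X (fst (\<pi> k v)) (snd (\<pi> k v)) \<omega>)
      \<le> tree_integral M X \<pi> (\<lambda>v. ennreal (max_load (\<Sum>i<n. v i))) r (Suc k) ?v"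
      by (simp only:)
  qed
  finally show ?case
    by (simp only: tree_integral.simps split_beta)
qed

lemma opt_value_le_expected_opt: "opt_value n {..<n} 0 \<le> expected_opt M n q X"
  unfolding expected_opt_def
proof (rule INF_greatest)
  fix \<pi> :: "'m policy" assume "\<pi> \<in> {\<pi>. adaptive_policy n q \<pi>}"
  then have \<pi>: "adaptive_policy n q \<pi>" by simp
  show "opt_value n {..<n} 0 \<le> expected_makespan M n X \<pi>"
    using opt_value_le_tree_integral[OF \<pi>, of "\<lambda>_. undefined" 0 n]
    by (simp add: expected_makespan_eq_tree_integral[OF \<pi>])
qed

end

subsection \<open>The restarting policy\<close>

lemma ennreal_le_two_times: "a \<le> 2 * (a :: ennreal)"
  by (simp add: mult_2)

context config_balancing
begin

text \<open>Taking the least code of a minimising action makes the choice measurable in \<open>l\<close>.\<close>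

definition best_action :: "nat \<Rightarrow> nat set \<Rightarrow> real ^ 'm \<Rightarrow> nat \<times> nat" where
  "best_action r J l = prod_decode (LEAST e. prod_decode e \<in> actions J \<and>
     action_value r J l (prod_decode e) = opt_value (Suc r) J l)"

lemma best_action:
  assumes "J \<subseteq> {..<n}" "J \<noteq> {}"
  shows "best_action r J l \<in> actions J"
    and "action_value r J l (best_action r J l) = opt_value (Suc r) J l"
proof -
  obtain a where "a \<in> actions J" "action_value r J l a = opt_value (Suc r) J l"
    using opt_value_attained[OF assms] .
  then have "prod_decode (prod_encode a) \<in> actions J \<and>
    action_value r J l (prod_decode (prod_encode a)) = opt_value (Suc r) J l"
    by simp
  from LeastI[where P = "\<lambda>e. prod_decode e \<in> actions J \<and>
      action_value r J l (prod_decode e) = opt_value (Suc r) J l", OF this]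
  show "best_action r J l \<in> actions J"
    and "action_value r J l (best_action r J l) = opt_value (Suc r) J l"
    by (simp_all add: best_action_def)
qed

lemma measurable_best_action:
  assumes J: "J \<subseteq> {..<n}"
  shows "best_action r J \<in> borel \<rightarrow>\<^sub>M count_space UNIV"
proof -
  have pred: "Measurable.pred borel (\<lambda>l. prod_decode e \<in> actions J \<and>
      action_value r J l (prod_decode e) = opt_value (Suc r) J l)" for e
  proof (cases "prod_decode e \<in> actions J")
    case True
    note [measurable] = borel_measurable_action_value[OF J True] borel_measurable_opt_value[OF J]
    show ?thesis using True by simp
  qed simp
  show ?thesis
    unfolding best_action_def[abs_def]
    by (rule measurable_compose[OF measurable_Least[OF pred]]) simp
qed

text \<open>These are exactly the actions that the last claim of the theorem rules out.\<close>

definition heavy :: "real \<Rightarrow> nat \<times> nat \<Rightarrow> bool" where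
  "heavy \<tau> a \<longleftrightarrow> ennreal \<tau> < (\<integral>\<^sup>+\<omega>. ennreal (max_load (X (fst a) (snd a) \<omega>)) \<partial>M)"

text \<open>The final makespan is at least the maximum entry of the vector drawn now. Hence a heavy
  minimiser at a nonnegative load certifies that the value exceeds \<open>\<tau>\<close>.\<close>

lemma expected_load_le_opt_value:
  fixes r :: nat
  assumes J: "J \<subseteq> {..<n}" "J \<noteq> {}" and "0 \<le> l"
  defines "a \<equiv> best_action r J l"
  shows "(\<integral>\<^sup>+\<omega>. ennreal (max_load (X (fst a) (snd a) \<omega>)) \<partial>M) \<le> opt_value (Suc r) J l"
proof -
  have "(\<integral>\<^sup>+\<omega>. ennreal (max_load (X (fst a) (snd a) \<omega>)) \<partial>M) \<le> action_value r J l a"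
    unfolding action_value_def
  proof (rule nn_integral_mono)
    fix \<omega>
    have "ennreal (max_load (X (fst a) (snd a) \<omega>)) \<le> ennreal (max_load (l + X (fst a) (snd a) \<omega>))"
      using \<open>0 \<le> l\<close> by (intro ennreal_leI max_load_mono) simp
    also have "\<dots> \<le> opt_value r (J - {fst a}) (l + X (fst a) (snd a) \<omega>)"
      using J by (intro max_load_le_opt_value) auto
    finally show "ennreal (max_load (X (fst a) (snd a) \<omega>)) \<le> opt_value r (J - {fst a}) (l + X (fst a) (snd a) \<omega>)" .
  qed
  also have "\<dots> = opt_value (Suc r) J l"
    unfolding a_def by (rule best_action(2)[OF J])
  finally show ?thesis .
qed

text \<open>This is the restart triggered before a choice is made; the one triggered by an observed
  vector is in \<open>state\<close>. After a reset, \<open>restart_action\<close> minimises afresh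
  at load 0.\<close>

definition phase_load :: "real \<Rightarrow> nat \<Rightarrow> nat set \<Rightarrow> real ^ 'm \<Rightarrow> real ^ 'm" where
  "phase_load \<tau> r J l = (if heavy \<tau> (best_action r J l) then 0 else l)"

definition restart_action :: "real \<Rightarrow> nat \<Rightarrow> nat set \<Rightarrow> real ^ 'm \<Rightarrow> nat \<times> nat" where
  "restart_action \<tau> r J l = best_action r J (phase_load \<tau> r J l)"

lemma measurable_phase_load:
  assumes "J \<subseteq> {..<n}"
  shows "phase_load \<tau> r J \<in> borel_measurable borel"
proof -
  note [measurable] = measurable_best_action[OF assms]
  show ?thesis unfolding phase_load_def[abs_def] by measurable
qed

lemma measurable_restart_action:
  assumes "J \<subseteq> {..<n}"
  shows "restart_action \<tau> r J \<in> borel \<rightarrow>\<^sub>M count_space UNIV"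
  unfolding restart_action_def[abs_def]
  by (rule measurable_compose[OF measurable_phase_load[OF assms] measurable_best_action[OF assms]])

text \<open>
  The second component of the state is the load since the last restart, not the total load.
\<close>

primrec state :: "real \<Rightarrow> nat \<Rightarrow> (nat \<Rightarrow> real ^ 'm) \<Rightarrow> nat set \<times> (real ^ 'm)" where
  "state \<tau> 0 v = ({..<n}, 0)"
| "state \<tau> (Suc k) v = (case state \<tau> k v of (J, l) \<Rightarrow>
     (J - {fst (restart_action \<tau> (n - Suc k) J l)},
      if \<tau> \<le> max_load (v k) then 0 else phase_load \<tau> (n - Suc k) J l + v k))"

text \<open>In step \<open>k\<close> there are \<open>n - k\<close> requests left, and
  \<open>n - Suc k\<close> after the choice, which is the counter that \<open>restart_action\<close>
  expects.\<close>

definition restart_policy :: "real \<Rightarrow> 'm policy" where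
  "restart_policy \<tau> k v = (case state \<tau> k v of (J, l) \<Rightarrow> restart_action \<tau> (n - Suc k) J l)"

section \<open>Admissibility of the restarting policy\<close>

lemma state_cong: "(\<And>i. i < k \<Longrightarrow> v i = w i) \<Longrightarrow> state \<tau> k v = state \<tau> k w"
  by (induction k) (simp_all add: split_beta)

lemma restart_policy_restrict: "restart_policy \<tau> k (restrict v {..<k}) = restart_policy \<tau> k v"
  unfolding restart_policy_def by (subst state_cong[of k "restrict v {..<k}" v]) auto

lemma restart_action_in_actions:
  "J \<subseteq> {..<n} \<Longrightarrow> J \<noteq> {} \<Longrightarrow> restart_action \<tau> r J l \<in> actions J"
  unfolding restart_action_def by (rule best_action(1))

lemma state_remaining:
  assumes "state \<tau> k v = (J, l)" "k \<le> n"
  shows "J \<subseteq> {..<n} \<and> card J = n - k"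
  using assms
proof (induction k arbitrary: J l)
  case (Suc k)
  obtain J' l' where s: "state \<tau> k v = (J', l')" by force
  with Suc have J': "J' \<subseteq> {..<n}" "card J' = n - k" by auto
  then have "J' \<noteq> {}" using Suc.prems by auto
  with J' have "fst (restart_action \<tau> (n - Suc k) J' l') \<in> J'"
    using restart_action_in_actions by (auto simp: actions_iff)
  with J' s Suc.prems show ?case
    by (auto simp: card_Diff_singleton_if)
qed auto

lemma state_remaining_step:
  assumes "state \<tau> k v = (J, l)" "k < n"
  shows "J \<subseteq> {..<n}" "J \<noteq> {}"
proof -
  have "J \<subseteq> {..<n} \<and> card J = n - k"
    using state_remaining[OF assms(1)] assms(2) by simp
  then show "J \<subseteq> {..<n}" "J \<noteq> {}" using assms(2) by auto
qed

text \<open>The history length \<open>m\<close> is kept apart from \<open>k\<close> so that the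
  induction stays on one product space.\<close>

lemma measurable_state:
  assumes "k \<le> m" "m \<le> n"
  shows "(\<lambda>v. fst (state \<tau> k v)) \<in> PiM {..<m} (\<lambda>_. borel) \<rightarrow>\<^sub>M count_space (Pow {..<n}) \<and>
    (\<lambda>v. snd (state \<tau> k v)) \<in> PiM {..<m} (\<lambda>_. borel) \<rightarrow>\<^sub>M borel"
  using assms(1)
proof (induction k)
  case (Suc k)
  let ?P = "PiM {..<m} (\<lambda>_. borel :: (real ^ 'm) measure)" and ?r = "n - Suc k"
  have J: "(\<lambda>v. fst (state \<tau> k v)) \<in> ?P \<rightarrow>\<^sub>M count_space (Pow {..<n})"
    and l[measurable]: "(\<lambda>v. snd (state \<tau> k v)) \<in> borel_measurable ?P"
    using Suc by auto
  have ctbl: "countable (Pow {..<n})" by (intro countable_finite) simp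
  have vk[measurable]: "(\<lambda>v. v k) \<in> borel_measurable ?P"
    using Suc.prems by (intro measurable_component_singleton) auto
  have "(\<lambda>v. fst (state \<tau> k v) - {fst (restart_action \<tau> ?r (fst (state \<tau> k v)) (snd (state \<tau> k v)))})
    \<in> ?P \<rightarrow>\<^sub>M count_space (Pow {..<n})"
  \<comment> \<open>The remaining set has finitely many values, so it may be treated as a constant
    \<open>K\<close>.\<close>
  proof (rule measurable_compose_countable'[OF _ J ctbl])
    fix K assume K: "K \<in> Pow {..<n}"
    have a: "(\<lambda>v. restart_action \<tau> ?r K (snd (state \<tau> k v))) \<in> ?P \<rightarrow>\<^sub>M count_space UNIV"
      using measurable_compose[OF l measurable_restart_action] K by simp
    show "(\<lambda>v. K - {fst (restart_action \<tau> ?r K (snd (state \<tau> k v)))}) \<in> ?P \<rightarrow>\<^sub>M count_space (Pow {..<n})"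
      using measurable_compose[OF a, of "\<lambda>a. K - {fst a}" "count_space (Pow {..<n})"] K by auto
  qed
  moreover have [measurable]: "(\<lambda>v. phase_load \<tau> ?r (fst (state \<tau> k v)) (snd (state \<tau> k v))) \<in> borel_measurable ?P"
    by (rule measurable_compose_countable'[OF _ J ctbl]) (auto intro!: measurable_compose[OF l measurable_phase_load])
  have "(\<lambda>v. if \<tau> \<le> max_load (v k) then 0 else phase_load \<tau> ?r (fst (state \<tau> k v)) (snd (state \<tau> k v)) + v k)
    \<in> borel_measurable ?P"
    by measurable
  ultimately show ?case
    by (simp add: split_beta)
qed auto

lemma measurable_restart_policy:
  assumes "k < n"
  shows "restart_policy \<tau> k \<in> PiM {..<k} (\<lambda>_. borel) \<rightarrow>\<^sub>M count_space UNIV"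
proof -
  let ?P = "PiM {..<k} (\<lambda>_. borel :: (real ^ 'm) measure)" and ?r = "n - Suc k"
  have J: "(\<lambda>v. fst (state \<tau> k v)) \<in> ?P \<rightarrow>\<^sub>M count_space (Pow {..<n})"
    and l: "(\<lambda>v. snd (state \<tau> k v)) \<in> borel_measurable ?P"
    using measurable_state[of k k \<tau>] assms by auto
  have "restart_action \<tau> ?r K \<in> borel \<rightarrow>\<^sub>M count_space UNIV" if "K \<in> Pow {..<n}" for K
    using that by (intro measurable_restart_action) auto
  from measurable_compose_countable'[OF measurable_compose[OF l this] J] show ?thesis
    unfolding restart_policy_def[abs_def] split_beta by (simp add: countable_finite)
qed

lemma adaptive_restart_policy: "adaptive_policy n q (restart_policy \<tau>)"
  unfolding adaptive_policy_def restart_policy_restrict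
proof (intro conjI allI impI)
  show "restart_policy \<tau> k \<in> PiM {..<k} (\<lambda>_. borel) \<rightarrow>\<^sub>M count_space UNIV" if "k < n" for k
    by (rule measurable_restart_policy[OF that])
next
  fix v :: "nat \<Rightarrow> real ^ 'm"
  have step: "restart_policy \<tau> k v \<in> actions (fst (state \<tau> k v))"
    "fst (state \<tau> k v) \<subseteq> {..<n}" if "k < n" for k
  proof -
    obtain J l where s: "state \<tau> k v = (J, l)" by force
    show "restart_policy \<tau> k v \<in> actions (fst (state \<tau> k v))" "fst (state \<tau> k v) \<subseteq> {..<n}"
      using restart_action_in_actions state_remaining_step[OF s that] by (simp_all add: restart_policy_def s)
  qed
  \<comment> \<open>A request leaves the state at the step that handles it and never
    returns.\<close>
  have used: "fst (restart_policy \<tau> i v) \<notin> fst (state \<tau> k v)" if "i < k" for i k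
    using that
  proof (induction k)
    case (Suc k)
    then show ?case
      by (cases "i = k") (auto simp: restart_policy_def split: prod.splits)
  qed simp
  have "inj_on (\<lambda>k. fst (restart_policy \<tau> k v)) {..<n}"
  proof (rule linorder_inj_onI')
    fix i k assume "i \<in> {..<n}" "k \<in> {..<n}" "i < k"
    then show "fst (restart_policy \<tau> i v) \<noteq> fst (restart_policy \<tau> k v)"
      using used[of i k] step(1)[of k] by (auto simp: actions_iff)
  qed
  moreover have "(\<lambda>k. fst (restart_policy \<tau> k v)) ` {..<n} \<subseteq> {..<n}"
    using step by (auto simp: actions_iff)
  ultimately show "bij_betw (\<lambda>k. fst (restart_policy \<tau> k v)) {..<n} {..<n}"
    by (simp add: bij_betw_def endo_inj_surj)
  show "case restart_policy \<tau> k v of (j, c) \<Rightarrow> c < q j" if "k < n" for k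
    using step(1)[OF that] by (simp add: actions_iff split_beta)
qed

section \<open>Cost of the restarting policy\<close>

lemma opt_value_state_le:
  assumes "state \<tau> k v = (J, l)" "k \<le> n"
  shows "opt_value (n - k) J 0 \<le> opt_value n {..<n} 0"
  using assms
proof (induction k arbitrary: J l)
  case (Suc k)
  obtain J' l' where s: "state \<tau> k v = (J', l')" by force
  note J' = state_remaining_step[OF s]
  have "J = J' - {fst (restart_action \<tau> (n - Suc k) J' l')}"
    using Suc.prems s by simp
  moreover have "fst (restart_action \<tau> (n - Suc k) J' l') \<in> J'"
    using restart_action_in_actions J' Suc.prems by (auto simp: actions_iff)
  \<comment> \<open>Each step removes one request, so the value at load 0 cannot grow: a restart is
    never dearer than the initial state.\<close>
  ultimately have "opt_value (n - Suc k) J 0 \<le> opt_value (Suc (n - Suc k)) J' 0"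
    using J' Suc.prems by (simp add: opt_value_remove)
  also have "Suc (n - Suc k) = n - k"
    using Suc.prems by simp
  finally show ?case
    using Suc.IH[OF s] Suc.prems by simp
qed simp

lemma not_heavy_best_action_0:
  assumes "J \<subseteq> {..<n}" "J \<noteq> {}" and "opt_value (Suc r) J 0 \<le> ennreal \<tau>"
  shows "\<not> heavy \<tau> (best_action r J 0)"
  using expected_load_le_opt_value[OF assms(1,2), of 0 r] assms(3) by (simp add: heavy_def)

text \<open>If the minimiser at the current load is heavy, the minimiser at load 0 is played
  instead, and the value there is at most \<open>\<tau>\<close>.\<close>

lemma not_heavy_restart_policy:
  assumes small: "2 * opt_value n {..<n} 0 \<le> ennreal \<tau>" and k: "k < n"
  shows "\<not> heavy \<tau> (restart_policy \<tau> k v)"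
proof -
  obtain J l where s: "state \<tau> k v = (J, l)" by force
  have "opt_value (n - k) J 0 \<le> ennreal \<tau>"
    using opt_value_state_le[OF s] k small ennreal_le_two_times order_trans
    by (metis less_imp_le)
  then have "\<not> heavy \<tau> (best_action (n - Suc k) J 0)"
    using k by (intro not_heavy_best_action_0 state_remaining_step[OF s k]) (simp add: Suc_diff_Suc)
  then show ?thesis
    by (simp add: restart_policy_def s restart_action_def phase_load_def)
qed

text \<open>
  \<open>\<Phi> k v l\<close> is the cost charged to the completed phases; it is instantiated once for the makespan
  and once for the exceptional load. A restart happens only when the value of the current phase is
  at least \<open>\<tau>\<close>, while the fresh phase costs at most \<open>2 * opt_value \<dots> 0 \<le> \<tau>\<close>: the second copy of
  the value pays for it.
\<close>

lemma tree_integral_restart_policy_le: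
  fixes \<Phi> :: "nat \<Rightarrow> (nat \<Rightarrow> real ^ 'm) \<Rightarrow> real ^ 'm \<Rightarrow> ennreal"
  assumes small: "2 * opt_value n {..<n} 0 \<le> ennreal \<tau>"
    and \<Phi>_regular: "\<And>k v l y. 0 \<le> l \<Longrightarrow> 0 \<le> y \<Longrightarrow> max_load y < \<tau> \<Longrightarrow>
      \<Phi> (Suc k) (v(k := y)) (l + y) \<le> \<Phi> k v l"
    and \<Phi>_exceptional: "\<And>k v l y. 0 \<le> l \<Longrightarrow> 0 \<le> y \<Longrightarrow> \<tau> \<le> max_load y \<Longrightarrow>
      \<Phi> (Suc k) (v(k := y)) 0 \<le> \<Phi> k v l + ennreal (max_load (l + y))"
    and \<Phi>_reset: "\<And>k v l. 0 \<le> l \<Longrightarrow> \<Phi> k v 0 \<le> \<Phi> k v l + ennreal (max_load l)"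
    and \<Phi>_final: "\<And>v l. 0 \<le> l \<Longrightarrow> G v \<le> \<Phi> n v l + 2 * ennreal (max_load l)"
    and "k + r = n" and "state \<tau> k v = (J, l)" and "0 \<le> l"
  shows "tree_integral M X (restart_policy \<tau>) G r k v \<le> \<Phi> k v l + 2 * opt_value r J l"
  using assms(6-8)
proof (induction r arbitrary: k v J l)
  case 0
  then show ?case using \<Phi>_final by simp
next
  case (Suc r)
  have k: "k < n" and r: "r = n - Suc k" "Suc r = n - k" using Suc.prems by auto
  note s = Suc.prems(2)
  note J = state_remaining_step[OF s k]
  \<comment> \<open>The load after a possible reset. The step is first bounded from
    \<open>l0\<close>; the reset from \<open>l\<close> to \<open>l0\<close> is accounted for at the
    end.\<close>
  define l0 where "l0 = phase_load \<tau> r J l"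
  define a where "a = best_action r J l0"
  have l0: "0 \<le> l0"
    using Suc.prems by (simp add: l0_def phase_load_def)
  have a: "a \<in> actions J" "action_value r J l0 a = opt_value (Suc r) J l0"
    unfolding a_def by (intro best_action J)+
  have \<pi>: "restart_policy \<tau> k v = a"
    using s by (simp add: restart_policy_def restart_action_def a_def l0_def r(1))
  have smallJ: "2 * opt_value (Suc r) J 0 \<le> ennreal \<tau>"
    using order_trans[OF mult_left_mono[OF opt_value_state_le[OF s]] small] k r(2) by simp
  let ?y = "\<lambda>\<omega>. X (fst a) (snd a) \<omega>"
  have step: "tree_integral M X (restart_policy \<tau>) G r (Suc k) (v(k := ?y \<omega>)) \<le>
      \<Phi> k v l0 + 2 * opt_value r (J - {fst a}) (l0 + ?y \<omega>)" if \<omega>: "\<omega> \<in> space M" for \<omega>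
  proof -
    let ?v = "v(k := ?y \<omega>)"
    have y: "0 \<le> ?y \<omega>" by (rule X_action_nonneg[OF J(1) a(1) \<omega>])
    have "state \<tau> k ?v = (J, l)"
      using state_cong[of k ?v v \<tau>] s by simp
    then have s': "state \<tau> (Suc k) ?v = (J - {fst a}, if \<tau> \<le> max_load (?y \<omega>) then 0 else l0 + ?y \<omega>)"
      by (simp add: l0_def a_def restart_action_def r(1))
    show ?thesis
    proof (cases "\<tau> \<le> max_load (?y \<omega>)")
      case False
      have "tree_integral M X (restart_policy \<tau>) G r (Suc k) ?v \<le>
          \<Phi> (Suc k) ?v (l0 + ?y \<omega>) + 2 * opt_value r (J - {fst a}) (l0 + ?y \<omega>)"
        using False s' l0 y Suc.prems(1) by (intro Suc.IH) (simp_all only: if_False add_Suc add_Suc_right add_nonneg_nonneg)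
      also have "\<dots> \<le> \<Phi> k v l0 + 2 * opt_value r (J - {fst a}) (l0 + ?y \<omega>)"
        using False l0 y by (intro add_right_mono \<Phi>_regular) auto
      finally show ?thesis .
    next
      case True
      have max: "ennreal (max_load (l0 + ?y \<omega>)) \<le> opt_value r (J - {fst a}) (l0 + ?y \<omega>)"
        using J by (intro max_load_le_opt_value) auto
      \<comment> \<open>Twice the value of the fresh phase is at most \<open>\<tau>\<close>, hence
        at most the load just reached, and so fits into one copy of the current value.\<close>
      have "2 * opt_value r (J - {fst a}) 0 \<le> 2 * opt_value (Suc r) J 0"
        using a(1) J by (intro mult_left_mono opt_value_remove) (auto simp: actions_iff)
      also note smallJ
      also have "ennreal \<tau> \<le> ennreal (max_load (l0 + ?y \<omega>))"
        using True max_load_mono[of "?y \<omega>" "l0 + ?y \<omega>"] l0 by (intro ennreal_leI) simp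
      finally have rest: "2 * opt_value r (J - {fst a}) 0 \<le> opt_value r (J - {fst a}) (l0 + ?y \<omega>)"
        using max by simp
      have "tree_integral M X (restart_policy \<tau>) G r (Suc k) ?v \<le>
          \<Phi> (Suc k) ?v 0 + 2 * opt_value r (J - {fst a}) 0"
        using True s' Suc.prems(1) by (intro Suc.IH) (simp_all only: if_True add_Suc add_Suc_right order_refl)
      also have "\<dots> \<le> (\<Phi> k v l0 + ennreal (max_load (l0 + ?y \<omega>))) + opt_value r (J - {fst a}) (l0 + ?y \<omega>)"
        using True l0 y by (intro add_mono \<Phi>_exceptional rest) auto
      \<comment> \<open>The other copy absorbs the maximum load of the phase that has just ended,
        now charged to \<open>\<Phi>\<close>.\<close>
      also have "\<dots> \<le> (\<Phi> k v l0 + opt_value r (J - {fst a}) (l0 + ?y \<omega>)) + opt_value r (J - {fst a}) (l0 + ?y \<omega>)"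
        by (intro add_right_mono add_left_mono max)
      finally show ?thesis
        by (simp add: mult_2 add.assoc)
    qed
  qed
  have meas: "(\<lambda>\<omega>. opt_value r (J - {fst a}) (l0 + ?y \<omega>)) \<in> borel_measurable M"
  proof -
    have [measurable]: "X (fst a) (snd a) \<in> borel_measurable M"
      using actions_D[OF J(1) a(1)] by auto
    have [measurable]: "opt_value r (J - {fst a}) \<in> borel_measurable borel"
      using J by (intro borel_measurable_opt_value) auto
    show ?thesis by measurable
  qed
  have "tree_integral M X (restart_policy \<tau>) G (Suc r) k v =
      (\<integral>\<^sup>+\<omega>. tree_integral M X (restart_policy \<tau>) G r (Suc k) (v(k := ?y \<omega>)) \<partial>M)"
    by (simp only: tree_integral.simps \<pi> split_beta)
  also have "\<dots> \<le> (\<integral>\<^sup>+\<omega>. \<Phi> k v l0 + 2 * opt_value r (J - {fst a}) (l0 + ?y \<omega>) \<partial>M)"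
    by (intro nn_integral_mono step)
  also have "\<dots> = \<Phi> k v l0 + 2 * opt_value (Suc r) J l0"
    using meas a(2) by (simp add: nn_integral_add nn_integral_cmult emeasure_space_1 action_value_def)
  also have "\<dots> \<le> \<Phi> k v l + 2 * opt_value (Suc r) J l"
  proof (cases "heavy \<tau> (best_action r J l)")
    case False
    then show ?thesis by (simp add: l0_def phase_load_def)
  next
    case True
    \<comment> \<open>A heavy minimiser at \<open>l\<close> forces a value of at least
      \<open>\<tau>\<close>, so the same accounting covers this restart.\<close>
    then have "ennreal \<tau> \<le> opt_value (Suc r) J l"
      using expected_load_le_opt_value[OF J Suc.prems(3), of r] by (simp add: heavy_def)
    with smallJ have rest: "2 * opt_value (Suc r) J 0 \<le> opt_value (Suc r) J l"
      by simp
    have "\<Phi> k v l0 + 2 * opt_value (Suc r) J l0 = \<Phi> k v 0 + 2 * opt_value (Suc r) J 0"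
      using True by (simp add: l0_def phase_load_def)
    also have "\<dots> \<le> (\<Phi> k v l + opt_value (Suc r) J l) + opt_value (Suc r) J l"
      using order_trans[OF \<Phi>_reset add_left_mono[OF max_load_le_opt_value]] Suc.prems(3) J rest
      by (intro add_mono) auto
    finally show ?thesis by (simp add: mult_2 add.assoc)
  qed
  finally show ?case .
qed

lemma expected_makespan_restart_policy_le:
  assumes small: "2 * opt_value n {..<n} 0 \<le> ennreal \<tau>"
  shows "expected_makespan M n X (restart_policy \<tau>) \<le> 2 * opt_value n {..<n} 0"
proof -
  \<comment> \<open>The part of the total load that stems from completed phases. A regular step
    leaves it unchanged; at a restart, subadditivity of \<open>max_load\<close> moves the phase load
    into it.\<close>
  define \<Phi> where "\<Phi> k v l = ennreal (max_load ((\<Sum>i<k. v i) - l))" for k and v :: "nat \<Rightarrow> real ^ 'm" and l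
  have split: "ennreal (max_load y) \<le> ennreal (max_load (y - l)) + ennreal (max_load l)" for y l :: "real ^ 'm"
    using order_trans[OF ennreal_leI[OF max_load_add_le[of "y - l" l]] ennreal_add_le] by simp
  have "tree_integral M X (restart_policy \<tau>) (\<lambda>v. ennreal (max_load (\<Sum>k<n. v k))) n 0 (\<lambda>_. undefined)
    \<le> \<Phi> 0 (\<lambda>_. undefined) 0 + 2 * opt_value n {..<n} 0"
  proof (rule tree_integral_restart_policy_le[OF small])
    fix k v and l y :: "real ^ 'm"
    have sum: "(\<Sum>i<Suc k. (v(k := y)) i) = (\<Sum>i<k. v i) + y"
      by simp
    show "\<Phi> (Suc k) (v(k := y)) (l + y) \<le> \<Phi> k v l"
      unfolding \<Phi>_def sum by simp
    show "\<Phi> (Suc k) (v(k := y)) 0 \<le> \<Phi> k v l + ennreal (max_load (l + y))"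
      unfolding \<Phi>_def sum using split[of "(\<Sum>i<k. v i) + y" "l + y"] by simp
    show "\<Phi> k v 0 \<le> \<Phi> k v l + ennreal (max_load l)"
      unfolding \<Phi>_def using split by simp
    show "ennreal (max_load (\<Sum>k<n. v k)) \<le> \<Phi> n v l + 2 * ennreal (max_load l)"
      unfolding \<Phi>_def using split[of "\<Sum>k<n. v k" l] by (rule order_trans) (intro add_left_mono ennreal_le_two_times)
  qed simp_all
  then show ?thesis
    by (simp add: expected_makespan_eq_tree_integral[OF adaptive_restart_policy] \<Phi>_def)
qed

lemma expected_exceptional_load_restart_policy_le:
  assumes small: "2 * opt_value n {..<n} 0 \<le> ennreal \<tau>"
  shows "expected_exceptional_load M n X \<tau> (restart_policy \<tau>) \<le> 2 * opt_value n {..<n} 0"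
proof -
  define e where "e y = ennreal (MAX i. exceptional_part \<tau> (y $ i))" for y :: "real ^ 'm"
  \<comment> \<open>The exceptional load seen so far. A vector reaching \<open>\<tau>\<close> ends
    its phase, so each phase contributes at most one nonzero term, bounded by the maximum load of
    that phase.\<close>
  define \<Phi> where "\<Phi> k v (l :: real ^ 'm) = (\<Sum>i<k. e (v i))" for k and v :: "nat \<Rightarrow> real ^ 'm" and l
  have e_regular: "e y = 0" if "max_load y < \<tau>" for y
  proof -
    have "exceptional_part \<tau> (y $ i) = 0" for i
      using that max_load_ge[of y i] by (simp add: exceptional_part_def)
    then show ?thesis by (simp add: e_def)
  qed
  have e_le: "e y \<le> ennreal (max_load y)" if "0 \<le> y" for y
  proof -
    have "exceptional_part \<tau> (y $ i) \<le> max_load y" for i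
      using max_load_ge[of y i] max_load_nonneg[OF that] by (simp add: exceptional_part_def indicator_def)
    then show ?thesis by (simp add: e_def ennreal_leI)
  qed
  have [measurable]: "e \<in> borel_measurable borel"
    unfolding e_def[abs_def] exceptional_part_def
    by (intro measurable_compose[OF _ measurable_ennreal] borel_measurable_Max) measurable
  have "tree_integral M X (restart_policy \<tau>) (\<lambda>v. \<Sum>k<n. e (v k)) n 0 (\<lambda>_. undefined)
    \<le> \<Phi> 0 (\<lambda>_. undefined) 0 + 2 * opt_value n {..<n} 0"
  proof (rule tree_integral_restart_policy_le[OF small])
    fix k v and l y :: "real ^ 'm"
    have sum: "(\<Sum>i<Suc k. e ((v(k := y)) i)) = (\<Sum>i<k. e (v i)) + e y"
      by simp
    show "\<Phi> (Suc k) (v(k := y)) (l + y) \<le> \<Phi> k v l" if "max_load y < \<tau>"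
      unfolding \<Phi>_def sum by (simp add: e_regular[OF that])
    show "\<Phi> (Suc k) (v(k := y)) 0 \<le> \<Phi> k v l + ennreal (max_load (l + y))" if "0 \<le> l" "0 \<le> y"
    proof -
      have "ennreal (max_load y) \<le> ennreal (max_load (l + y))"
        using that by (intro ennreal_leI max_load_mono) simp
      then show ?thesis
        unfolding \<Phi>_def sum using e_le[OF that(2)] by (intro add_left_mono) (rule order_trans)
    qed
  qed (simp_all add: \<Phi>_def)
  then show ?thesis
    using sum_expected_selected_eq_tree_integral[OF adaptive_restart_policy, of e \<tau>]
    by (simp add: expected_exceptional_load_def e_def[symmetric] \<Phi>_def)
qed

text \<open>Here \<omega> only fixes the configuration, and the expectation is over a separate
  \<omega>'. Since \<open>not_heavy_restart_policy\<close> covers every history, no null set has to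
  be excluded.\<close>

lemma expected_load_selected_restart_policy_le:
  assumes small: "2 * opt_value n {..<n} 0 \<le> ennreal \<tau>" and "j < n"
  shows "(\<integral>\<^sup>+\<omega>'. ennreal (max_load (X j (selected n X (restart_policy \<tau>) j \<omega>) \<omega>')) \<partial>M) \<le> ennreal \<tau>"
proof -
  let ?a = "\<lambda>k. restart_policy \<tau> k (observed X (restart_policy \<tau>) k \<omega>)"
  have "j \<in> (\<lambda>k. fst (?a k)) ` {..<n}"
    using bij_betw_imp_surj_on[OF bij_betw_chosen[OF adaptive_restart_policy, where X = X]] \<open>j < n\<close> by simp
  then obtain k where k: "k < n" "fst (?a k) = j"
    by (elim imageE) auto
  with selected_chosen[OF adaptive_restart_policy k(1), of X \<tau> \<omega>]
    not_heavy_restart_policy[OF small k(1), of "observed X (restart_policy \<tau>) k \<omega>"]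
  show ?thesis by (simp add: heavy_def not_less)
qed

end

theorem theorem5:
  fixes M :: "'w measure"
    and n :: nat
    and q :: "nat \<Rightarrow> nat"
    and X :: "nat \<Rightarrow> nat \<Rightarrow> 'w \<Rightarrow> real ^ 'm::finite"
    and \<tau> :: real
  assumes "config_balancing M n q X"
    and "0 \<le> \<tau>"
    and "2 * expected_opt M n q X \<le> ennreal \<tau>"
  shows "\<exists>\<pi>. adaptive_policy n q \<pi> \<and>
           expected_makespan M n X \<pi> \<le> 2 * expected_opt M n q X \<and>
           expected_exceptional_load M n X \<tau> \<pi> \<le> 2 * expected_opt M n q X \<and>
           (\<forall>\<omega>\<in>space M. \<forall>j<n.
              (\<integral>\<^sup>+\<omega>'. ennreal (MAX i. X j (selected n X \<pi> j \<omega>) \<omega>' $ i) \<partial>M) \<le> ennreal \<tau>)"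
proof -
  interpret config_balancing M n q X by fact
  have le: "2 * opt_value n {..<n} 0 \<le> 2 * expected_opt M n q X"
    by (intro mult_left_mono opt_value_le_expected_opt) simp
  then have small: "2 * opt_value n {..<n} 0 \<le> ennreal \<tau>"
    using assms(3) by (rule order_trans)
  show ?thesis
    using adaptive_restart_policy
      order_trans[OF expected_makespan_restart_policy_le[OF small] le]
      order_trans[OF expected_exceptional_load_restart_policy_le[OF small] le]
      expected_load_selected_restart_policy_le[OF small, unfolded max_load_def]
    by (intro exI[of _ "restart_policy \<tau>"]) simp
qed

end
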